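(* For $k\ge 0$ and $\theta\in[0,2\pi]$, $$\frac{1}{2m+1}\sum_{\nu=0}^{2m}U_k(\phi_\nu;\cos\theta,\sin\theta)\,U_k(\phi_\nu;x,y)=U_k(\theta;x,y),\qquad (x,y)\in B^2.$$
   Context: $m$ is a nonnegative integer, $k$ is an integer, and $\phi_\nu=\frac{2\pi\nu}{2m+1}$ for $0\le\nu\le 2m$. $B^2=\{(x,y)\in\mathbb{R}^2: x^2+y^2\le 1\}$ is the unit disk. $U_k$ is the Chebyshev polynomial of the second kind, $U_k(\cos\theta)=\sin((k+1)\theta)/\sin\theta$, and $U_k(\theta;x,y):=U_k(x\cos\theta+y\sin\theta)$ is the corresponding ridge polynomial.
   Formalization: The formal statement adds the condition k ≤ 2m; without it the identity is false (m=0, k=1, θ=0, (x,y)=(1,0) gives 4 on the left and 2 on the right), and for every k > 2m it fails for some θ and (x,y). *)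

theory Defs
  imports "HOL-Analysis.Analysis" "HOL-Computational_Algebra.Polynomial"
begin

definition chebyshev_U :: "nat \<Rightarrow> real poly" where
  "chebyshev_U k = (THE p. \<forall>\<theta>. sin \<theta> \<noteq> 0 \<longrightarrow> poly p (cos \<theta>) = sin (real (k + 1) * \<theta>) / sin \<theta>)"

(* The description above is proper: such a polynomial exists and is unique. *)

lemma chebyshev_U_exists:
  "\<exists>p :: real poly. \<forall>\<theta>. sin \<theta> \<noteq> 0 \<longrightarrow> poly p (cos \<theta>) = sin (real (k + 1) * \<theta>) / sin \<theta>"
proof (induction k rule: induct_nat_012)
  case 0
  show ?case by (rule exI[of _ 1]) simp
next
  case 1
  show ?case by (rule exI[of _ "[:0, 2:]"]) (simp add: sin_double)
next
  case (ge2 n)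
  then obtain p q :: "real poly"
    where p: "\<forall>\<theta>. sin \<theta> \<noteq> 0 \<longrightarrow> poly p (cos \<theta>) = sin (real (n + 1) * \<theta>) / sin \<theta>"
      and q: "\<forall>\<theta>. sin \<theta> \<noteq> 0 \<longrightarrow> poly q (cos \<theta>) = sin (real (Suc n + 1) * \<theta>) / sin \<theta>"
    by blast
  have rec: "sin (real (Suc (Suc n) + 1) * \<theta>)
      = 2 * cos \<theta> * sin (real (Suc n + 1) * \<theta>) - sin (real (n + 1) * \<theta>)" for \<theta> :: real
  proof -
    have a: "real (Suc (Suc n) + 1) * \<theta> = real (Suc n + 1) * \<theta> + \<theta>"
      and b: "real (n + 1) * \<theta> = real (Suc n + 1) * \<theta> - \<theta>"
      by (simp_all add: algebra_simps)
    show ?thesis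
      unfolding a b sin_add sin_diff by simp
  qed
  show ?case
  proof (intro exI allI impI)
    fix \<theta> :: real
    assume s: "sin \<theta> \<noteq> 0"
    show "poly ([:0, 2:] * q - p) (cos \<theta>) = sin (real (Suc (Suc n) + 1) * \<theta>) / sin \<theta>"
      unfolding rec using p q s by (simp add: diff_divide_distrib)
  qed
qed

lemma chebyshev_U_unique:
  fixes p q :: "real poly"
  assumes p: "\<forall>\<theta>. sin \<theta> \<noteq> 0 \<longrightarrow> poly p (cos \<theta>) = sin (real (k + 1) * \<theta>) / sin \<theta>"
    and q: "\<forall>\<theta>. sin \<theta> \<noteq> 0 \<longrightarrow> poly q (cos \<theta>) = sin (real (k + 1) * \<theta>) / sin \<theta>"
  shows "p = q"
proof -
  have "poly (p - q) x = 0" if "x \<in> {-1<..<1}" for x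
  proof -
    from that have x: "-1 < x" "x < 1" by auto
    have "sin (arccos x) \<noteq> 0"
      using x by (rule sin_arccos_nonzero)
    with p q have "poly p (cos (arccos x)) = poly q (cos (arccos x))" by metis
    then show ?thesis using x by simp
  qed
  then have "{-1<..<1} \<subseteq> {x. poly (p - q) x = 0}" by blast
  moreover have "infinite {-1<..<(1::real)}" by simp
  ultimately have "infinite {x. poly (p - q) x = 0}"
    using finite_subset by blast
  then show ?thesis
    using poly_roots_finite[of "p - q"] by auto
qed

lemma poly_chebyshev_U_cos:
  assumes "sin \<theta> \<noteq> 0"
  shows "poly (chebyshev_U k) (cos \<theta>) = sin (real (k + 1) * \<theta>) / sin \<theta>"
proof -
  have "\<exists>!p :: real poly. \<forall>\<theta>. sin \<theta> \<noteq> 0 \<longrightarrow> poly p (cos \<theta>) = sin (real (k + 1) * \<theta>) / sin \<theta>"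
    using chebyshev_U_exists[of k] chebyshev_U_unique[of _ k] by blast
  from theI'[OF this] assms show ?thesis
    unfolding chebyshev_U_def by blast
qed

definition ridge_U :: "nat \<Rightarrow> real \<Rightarrow> real \<Rightarrow> real \<Rightarrow> real" where
  "ridge_U k \<theta> x y = poly (chebyshev_U k) (x * cos \<theta> + y * sin \<theta>)"

(* Averaging U_k(\<phi>; cos \<theta>, sin \<theta>) * U_k(\<phi>; x, y) over the 2m+1 nodes \<phi> m \<nu>
   reproduces U_k(\<theta>; x, y) exactly when k \<le> 2m.  For k > 2m distinct frequencies
   of the two factors coincide at the nodes: with m = 0, k = 1 the average is
   4 x cos \<theta>, whereas U_1(\<theta>; x, y) = 2 (x cos \<theta> + y sin \<theta>). *)
definition \<phi> :: "nat \<Rightarrow> nat \<Rightarrow> real" where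
  "\<phi> m \<nu> = 2 * pi * real \<nu> / (2 * real m + 1)"

definition unit_disk :: "(real \<times> real) set" where
  "unit_disk = {(x, y). x\<^sup>2 + y\<^sup>2 \<le> 1}"

end

theory Submission
  imports Defs
begin

text \<open>
  Put \<open>z = exp (i \<phi>)\<close>. Since \<open>x cos \<phi> + y sin \<phi> = a z + b / z\<close>, the three-term recurrence shows
  that \<open>U\<^sub>k(\<phi>; x, y)\<close> is a trigonometric polynomial in \<open>\<phi>\<close> that involves only the frequencies
  \<open>2 l - k\<close> with \<open>0 \<le> l \<le> k\<close>. For \<open>(x, y) = (cos \<theta>, sin \<theta>)\<close> it is the kernel
  \<open>U\<^sub>k(cos (\<theta> - \<phi>)) = (\<Sum>j\<le>k. exp (i (2 j - k) (\<theta> - \<phi>)))\<close>. The product of two terms has the frequency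
  \<open>2 (l - j)\<close> in \<open>\<phi>\<close>; as \<open>2 m + 1\<close> is odd and \<open>\<bar>l - j\<bar> \<le> k < 2 m + 1\<close>, its average over the nodes
  vanishes unless \<open>l = j\<close>, so the kernel reproduces every such trigonometric polynomial.
\<close>

lemma chebyshev_U_eqI:
  assumes "\<And>\<theta>. sin \<theta> \<noteq> 0 \<Longrightarrow> poly p (cos \<theta>) = sin (real (k + 1) * \<theta>) / sin \<theta>"
  shows "chebyshev_U k = p"
  using chebyshev_U_unique[of "chebyshev_U k" k p] poly_chebyshev_U_cos assms by blast

lemma chebyshev_U_0: "chebyshev_U 0 = 1"
  by (rule chebyshev_U_eqI) simp

lemma chebyshev_U_1: "chebyshev_U (Suc 0) = [:0, 2:]"
  by (rule chebyshev_U_eqI) (simp add: sin_double)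

lemma chebyshev_U_Suc_Suc:
  "chebyshev_U (Suc (Suc n)) = [:0, 2:] * chebyshev_U (Suc n) - chebyshev_U n"
proof (rule chebyshev_U_eqI)
  fix \<theta> :: real
  assume s: "sin \<theta> \<noteq> 0"
  have a: "real (Suc (Suc n) + 1) * \<theta> = real (Suc n + 1) * \<theta> + \<theta>"
    and b: "real (n + 1) * \<theta> = real (Suc n + 1) * \<theta> - \<theta>"
    by (simp_all add: algebra_simps)
  have "sin (real (Suc (Suc n) + 1) * \<theta>)
      = 2 * cos \<theta> * sin (real (Suc n + 1) * \<theta>) - sin (real (n + 1) * \<theta>)"
    unfolding a b sin_add sin_diff by simp
  then show "poly ([:0, 2:] * chebyshev_U (Suc n) - chebyshev_U n) (cos \<theta>)
      = sin (real (Suc (Suc n) + 1) * \<theta>) / sin \<theta>"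
    using s by (simp add: poly_chebyshev_U_cos diff_divide_distrib del: of_nat_Suc)
qed

text \<open>The polynomial \<open>z\<^sup>k U\<^sub>k(a z + b / z)\<close> in the variable \<open>z\<^sup>2\<close>.\<close>

fun laurent_U :: "complex \<Rightarrow> complex \<Rightarrow> nat \<Rightarrow> complex poly" where
  "laurent_U a b 0 = 1"
| "laurent_U a b (Suc 0) = [:2 * b, 2 * a:]"
| "laurent_U a b (Suc (Suc n)) =
    [:2 * b, 2 * a:] * laurent_U a b (Suc n) - [:0, 1:] * laurent_U a b n"

lemma degree_laurent_U: "degree (laurent_U a b k) \<le> k"
proof (induction k rule: induct_nat_012)
  case (ge2 n)
  have "degree ([:2 * b, 2 * a:] * laurent_U a b (Suc n)) \<le> 1 + Suc n"
    by (rule order_trans[OF degree_mult_le add_mono[OF _ ge2(2)]]) simp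
  moreover have "degree ([:0, 1:] * laurent_U a b n) \<le> 1 + n"
    by (rule order_trans[OF degree_mult_le add_mono[OF _ ge2(1)]]) simp
  ultimately show ?case
    unfolding laurent_U.simps(3) by (intro degree_diff_le) linarith+
qed simp_all

text \<open>Here \<open>u\<close> plays the role of \<open>1 / z\<close>. Multiplying the three-term
  recurrence at \<open>t\<close> by \<open>z ^ (n + 2)\<close> turns the factor \<open>2 * t\<close>
  into \<open>2 * a * z\<^sup>2 + 2 * b\<close> and leaves \<open>z\<^sup>2\<close> in front of the
  older term, which is the recursion of \<open>laurent_U\<close>.\<close>

lemma poly_chebyshev_U_laurent:
  assumes "complex_of_real t = a * z + b * u" and "z * u = 1"
  shows "complex_of_real (poly (chebyshev_U k) t) = u ^ k * poly (laurent_U a b k) (z\<^sup>2)"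
proof (induction k rule: induct_nat_012)
  case 0
  show ?case by (simp add: chebyshev_U_0)
next
  case 1
  have "u * z\<^sup>2 = z"
    using assms(2) by (metis mult.commute mult.left_commute mult_1_right power2_eq_square)
  then have "u * (2 * b + z\<^sup>2 * (2 * a)) = 2 * (a * z + b * u)"
    by (simp add: algebra_simps)
  then show ?case by (simp add: chebyshev_U_1 assms(1))
next
  case (ge2 n)
  let ?P = "poly (laurent_U a b n) (z\<^sup>2)" and ?Q = "poly (laurent_U a b (Suc n)) (z\<^sup>2)"
  have uz: "u * z\<^sup>2 = z" "u * u * z\<^sup>2 = 1"
    using assms(2) by algebra+
  have "complex_of_real (poly (chebyshev_U (Suc (Suc n))) t)
      = 2 * (a * z + b * u) * (u ^ Suc n * ?Q) - u ^ n * ?P"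
    unfolding assms(1)[symmetric] ge2[symmetric] by (simp add: chebyshev_U_Suc_Suc)
  \<comment> \<open>The identities \<open>uz\<close> are used from right to left, so that
    \<open>u ^ (n + 2)\<close> can be factored out of both terms.\<close>
  also have "\<dots> = 2 * (a * (u * z\<^sup>2) + b * u) * (u ^ Suc n * ?Q) - (u * u * z\<^sup>2) * u ^ n * ?P"
    by (simp add: uz)
  also have "\<dots> = u ^ Suc (Suc n) * ((2 * b + z\<^sup>2 * (2 * a)) * ?Q - z\<^sup>2 * ?P)"
    by (simp add: algebra_simps)
  also have "(2 * b + z\<^sup>2 * (2 * a)) * ?Q - z\<^sup>2 * ?P = poly (laurent_U a b (Suc (Suc n))) (z\<^sup>2)"
    by (simp add: algebra_simps)
  finally show ?case .
qed

text \<open>For \<open>a = b = 1 / 2\<close> the recursion is that of geometric sums: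
  \<open>S (n + 2) = (1 + w) * S (n + 1) - w * S n\<close>.\<close>

lemma poly_laurent_U_half: "poly (laurent_U (1 / 2) (1 / 2) k) w = (\<Sum>j\<le>k. w ^ j)"
  by (induction k rule: induct_nat_012) (simp_all add: algebra_simps)

text \<open>With \<open>z = cis \<psi>\<close> one has
  \<open>cos \<psi> = z / 2 + 1 / (2 * z)\<close>, the case of the geometric sum.\<close>

lemma chebyshev_U_cos_eq_sum_cis:
  "complex_of_real (poly (chebyshev_U k) (cos \<psi>)) = (\<Sum>j\<le>k. cis ((2 * real j - real k) * \<psi>))"
proof -
  have "complex_of_real (poly (chebyshev_U k) (cos \<psi>))
      = cis (- \<psi>) ^ k * poly (laurent_U (1 / 2) (1 / 2) k) ((cis \<psi>)\<^sup>2)"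
    by (rule poly_chebyshev_U_laurent) (simp_all add: complex_eq_iff cis_mult)
  also have "\<dots> = (\<Sum>j\<le>k. cis ((2 * real j - real k) * \<psi>))"
    by (simp add: poly_laurent_U_half sum_distrib_left Complex.DeMoivre cis_mult algebra_simps)
  finally show ?thesis .
qed

text \<open>With \<open>z = cis \<theta>\<close> and \<open>a = (x - i y) / 2\<close>, the ridge
  argument is \<open>a * z\<close> plus its conjugate. The coefficients depend on \<open>x\<close>,
  \<open>y\<close>, \<open>k\<close> but not on \<open>\<theta>\<close>, so the same ones serve at
  every node and at the target angle.\<close>

lemma ridge_U_eq_sum_cis:
  "complex_of_real (ridge_U k \<theta> x y) =
    (\<Sum>l\<le>k. coeff (laurent_U (Complex (x / 2) (- y / 2)) (Complex (x / 2) (y / 2)) k) l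
      * cis ((2 * real l - real k) * \<theta>))"
proof -
  let ?P = "laurent_U (Complex (x / 2) (- y / 2)) (Complex (x / 2) (y / 2)) k"
  have "complex_of_real (ridge_U k \<theta> x y) = cis (- \<theta>) ^ k * poly ?P ((cis \<theta>)\<^sup>2)"
    unfolding ridge_U_def
    by (rule poly_chebyshev_U_laurent) (simp_all add: complex_eq_iff cis_mult algebra_simps)
  \<comment> \<open>The degree may be less than \<open>k\<close>; the added coefficients are
    zero.\<close>
  also have "poly ?P ((cis \<theta>)\<^sup>2) = (\<Sum>l\<le>k. coeff ?P l * ((cis \<theta>)\<^sup>2) ^ l)"
    unfolding poly_altdef using degree_laurent_U[of _ _ k]
    by (intro sum.mono_neutral_left) (auto simp: coeff_eq_0)
  also have "cis (- \<theta>) ^ k * \<dots> = (\<Sum>l\<le>k. coeff ?P l * cis ((2 * real l - real k) * \<theta>))"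
  proof -
    have "cis (- \<theta>) ^ k * (c * ((cis \<theta>)\<^sup>2) ^ l) = c * cis ((2 * real l - real k) * \<theta>)" for c l
      by (simp add: Complex.DeMoivre cis_mult mult.left_commute[of _ c] algebra_simps)
    then show ?thesis by (simp only: sum_distrib_left)
  qed
  finally show ?thesis .
qed

text \<open>For \<open>d \<noteq> 0\<close> this is a full geometric sum over the powers of a root
  of unity \<open>q\<close> with \<open>q ^ (2 * m + 1) = 1\<close>. Only
  \<open>q \<noteq> 1\<close> needs an argument: otherwise \<open>2 * m + 1\<close> divides
  \<open>2 * d\<close>.\<close>

lemma sum_cis_nodes:
  fixes d :: int
  assumes "\<bar>d\<bar> \<le> 2 * int m"
  shows "(\<Sum>\<nu> = 0..2 * m. cis (2 * of_int d * \<phi> m \<nu>)) = (if d = 0 then 2 * of_nat m + 1 else 0)"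
proof (cases "d = 0")
  case True
  then show ?thesis by simp
next
  case False
  define n where "n = 2 * m + 1"
  have n: "real n = 2 * real m + 1" "real n \<noteq> 0" by (simp_all add: n_def)
  define q where "q = cis (2 * pi * (2 * of_int d / real n))"
  have pow: "cis (2 * of_int d * \<phi> m \<nu>) = q ^ \<nu>" for \<nu>
    unfolding q_def Complex.DeMoivre \<phi>_def n(1)[symmetric] by (simp add: field_simps)
  have "q \<noteq> 1"
  proof
    assume "q = 1"
    then have "cos (2 * pi * (2 * of_int d / real n)) = 1"
      by (simp add: q_def complex_eq_iff)
    then obtain i :: int where "2 * pi * (2 * of_int d / real n) = of_int i * 2 * pi"
      unfolding cos_one_2pi_int by auto
    then have "2 * real_of_int d = of_int i * real n"
      using n(2) by (simp add: field_simps)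
    then have "2 * d = i * int n"
      by (metis of_int_eq_iff of_int_mult of_int_numeral of_int_of_nat_eq)
    then have "int n dvd 2 * d" by simp
    \<comment> \<open>Since \<open>n\<close> is odd, the factor 2 cancels, and a nonzero multiple of
      \<open>n = 2 * m + 1\<close> exceeds the bound on \<open>d\<close>.\<close>
    moreover have "coprime (int n) 2" by (simp add: n_def)
    ultimately have "int n dvd d" by (simp add: coprime_dvd_mult_right_iff)
    with False have "int n \<le> \<bar>d\<bar>" using dvd_imp_le_int[of d "int n"] by simp
    with assms show False by (simp add: n_def)
  qed
  have "q ^ n = cis (2 * pi * of_int (2 * d))"
    unfolding q_def Complex.DeMoivre using n(2) by (simp add: field_simps)
  also have "\<dots> = 1" by (rule cis_multiple_2pi) simp
  finally have "q ^ n = 1" .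
  with \<open>q \<noteq> 1\<close> have "(\<Sum>\<nu><n. q ^ \<nu>) = 0"
    by (simp add: geometric_sum)
  moreover have "{0..2 * m} = {..<n}" by (auto simp: n_def)
  ultimately show ?thesis using False by (simp add: pow)
qed

text \<open>Exchanging the sums leaves the frequency \<open>2 * (l - j)\<close> at the nodes, and
  \<open>\<bar>l - j\<bar> \<le> k \<le> 2 * m\<close> lets \<open>sum_cis_nodes\<close> remove
  every term but \<open>j = l\<close>.\<close>

lemma average_cis_kernel:
  assumes "k \<le> 2 * m" and "l \<le> k"
  shows "(\<Sum>\<nu> = 0..2 * m. (\<Sum>j\<le>k. cis ((2 * real j - real k) * (\<theta> - \<phi> m \<nu>)))
      * cis ((2 * real l - real k) * \<phi> m \<nu>))
    = (2 * of_nat m + 1) * cis ((2 * real l - real k) * \<theta>)"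
proof -
  have product: "cis ((2 * real j - real k) * (\<theta> - \<phi> m \<nu>)) * cis ((2 * real l - real k) * \<phi> m \<nu>)
      = cis ((2 * real j - real k) * \<theta>) * cis (2 * of_int (int l - int j) * \<phi> m \<nu>)" for j \<nu>
    by (simp add: cis_mult algebra_simps)
  have "(\<Sum>\<nu> = 0..2 * m. (\<Sum>j\<le>k. cis ((2 * real j - real k) * (\<theta> - \<phi> m \<nu>)))
      * cis ((2 * real l - real k) * \<phi> m \<nu>))
    = (\<Sum>j\<le>k. cis ((2 * real j - real k) * \<theta>)
        * (\<Sum>\<nu> = 0..2 * m. cis (2 * of_int (int l - int j) * \<phi> m \<nu>)))"
    unfolding sum_distrib_right sum_distrib_left product by (rule sum.swap)
  also have "\<dots> = (\<Sum>j\<le>k. cis ((2 * real j - real k) * \<theta>) * (if j = l then 2 * of_nat m + 1 else 0))"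
    using assms by (intro sum.cong refl) (subst sum_cis_nodes, auto)
  also have "\<dots> = (2 * of_nat m + 1) * cis ((2 * real l - real k) * \<theta>)"
    using assms(2) by (simp add: if_distrib[of "(*) _"] cong: if_cong)
  finally show ?thesis .
qed

theorem proposition2p4:
  fixes m k :: nat and \<theta> x y :: real
  assumes "k \<le> 2 * m"
    and "\<theta> \<in> {0..2 * pi}"
    and "(x, y) \<in> unit_disk"
  shows "1 / (2 * real m + 1) *
      (\<Sum>\<nu> = 0..2 * m. ridge_U k (\<phi> m \<nu>) (cos \<theta>) (sin \<theta>) * ridge_U k (\<phi> m \<nu>) x y)
    = ridge_U k \<theta> x y"
proof -
  let ?c = "coeff (laurent_U (Complex (x / 2) (- y / 2)) (Complex (x / 2) (y / 2)) k)"
  let ?S = "\<Sum>\<nu> = 0..2 * m. ridge_U k (\<phi> m \<nu>) (cos \<theta>) (sin \<theta>) * ridge_U k (\<phi> m \<nu>) x y"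
  define K where "K \<nu> = (\<Sum>j\<le>k. cis ((2 * real j - real k) * (\<theta> - \<phi> m \<nu>)))" for \<nu>
  \<comment> \<open>At the point \<open>(cos \<theta>, sin \<theta>)\<close> the ridge argument is
    \<open>cos (\<theta> - \<phi> m \<nu>)\<close>.\<close>
  have kernel: "complex_of_real (ridge_U k (\<phi> m \<nu>) (cos \<theta>) (sin \<theta>)) = K \<nu>" for \<nu>
    unfolding ridge_U_def K_def cos_diff[symmetric] by (rule chebyshev_U_cos_eq_sum_cis)
  have "complex_of_real ?S
      = (\<Sum>\<nu> = 0..2 * m. \<Sum>l\<le>k. ?c l * (K \<nu> * cis ((2 * real l - real k) * \<phi> m \<nu>)))"
    by (simp only: of_real_sum of_real_mult kernel ridge_U_eq_sum_cis[of k _ x y] sum_distrib_left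
        mult.left_commute)
  \<comment> \<open>The coefficients are the same at all nodes, so averaging acts on each frequency
    separately.\<close>
  also have "\<dots> = (\<Sum>l\<le>k. ?c l * (\<Sum>\<nu> = 0..2 * m. K \<nu> * cis ((2 * real l - real k) * \<phi> m \<nu>)))"
    unfolding sum_distrib_left by (rule sum.swap)
  also have "\<dots> = (\<Sum>l\<le>k. ?c l * ((2 * of_nat m + 1) * cis ((2 * real l - real k) * \<theta>)))"
    unfolding K_def using assms(1) by (intro sum.cong refl) (simp add: average_cis_kernel)
  also have "\<dots> = complex_of_real ((2 * real m + 1) * ridge_U k \<theta> x y)"
    by (simp add: ridge_U_eq_sum_cis sum_distrib_left mult.left_commute)
  finally have "?S = (2 * real m + 1) * ridge_U k \<theta> x y"
    unfolding of_real_eq_iff .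
  then show ?thesis by (simp add: field_simps)
qed

end
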